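(* Let $\rho>0$, let $j\ge 1$ be an integer, and suppose that $f$ is $j$ times continuously differentiable at $a\in\mathbb{R}$. Then $$\left(\gamma^jf\right)(a)=\lim_{x\to a^+}\sum_{i=1}^j\lambda_{i,j}\,x^{i-j\rho}f^{(i)}(x),$$ where $(\lambda_{i,j})_{0\le i\le m,\ 1\le j\le m}$ is the sequence given recursively by $$\lambda_{i,j}=\begin{cases}0&\text{if } i=0\text{ or } i>j,\\ 1&\text{if } i=j,\\ \lambda_{i-1,j-1}+\big(i-(j-1)\rho\big)\lambda_{i,j-1}&\text{if } 1\le i<j.\end{cases}$$
   Context: Here $\gamma:=x^{1-\rho}\,\frac{d}{dx}$ and $\gamma^j=\gamma\circ\cdots\circ\gamma$ ($j$ times), and $f^{(i)}$ denotes the classical $i$-th derivative of $f$. In the index range of $\lambda_{i,j}$, $m$ is a positive integer with $m\ge j$ for the $j$ under consideration.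
   Formalization: At a=0, where both sides may fail to exist (ρ=2, j=1, f(x)=x), (γ^j f)(0) is read as the right-hand limit of γ^j f and the equality as "both sides exist together and agree"; for negative x the powers of x are principal complex powers. *)

theory Defs
  imports "HOL-Analysis.Analysis"
begin

text \<open>
  The operator \<open>x\<^bsup>1-\<rho>\<^esup> d/dx\<close>. Powers with real exponent are principal complex powers, so that they
  make sense on the negative half-line as well; for \<open>x > 0\<close> they are the usual real powers. Hence
  the operator acts on complex-valued functions of a real variable. Its values at \<open>0\<close> are junk
  and are not used below.
\<close>

definition gamma_op :: "real \<Rightarrow> (real \<Rightarrow> complex) \<Rightarrow> real \<Rightarrow> complex" where
  "gamma_op \<rho> g x =
     complex_of_real x powr complex_of_real (1 - \<rho>) * vector_derivative g (at x)"

definition gamma_pow :: "real \<Rightarrow> nat \<Rightarrow> (real \<Rightarrow> real) \<Rightarrow> real \<Rightarrow> complex" where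
  "gamma_pow \<rho> j f = (gamma_op \<rho> ^^ j) (\<lambda>x. complex_of_real (f x))"

text \<open>
  The \<open>j\<close>-th iterate is defined at \<open>a\<close> and has the value \<open>L\<close> there. For \<open>a \<noteq> 0\<close> this is the
  pointwise value. At \<open>a = 0\<close>, where the factor \<open>x\<^bsup>1-\<rho>\<^esup>\<close> is singular for \<open>\<rho> > 1\<close> and may fail
  to be differentiable for \<open>\<rho> < 1\<close>, it is the limit from the right of the pointwise values, which
  may or may not exist. The first conjunct says that every derivative taken on the way exists.
\<close>

definition gamma_pow_has_value :: "real \<Rightarrow> nat \<Rightarrow> (real \<Rightarrow> real) \<Rightarrow> real \<Rightarrow> complex \<Rightarrow> bool" where
  "gamma_pow_has_value \<rho> j f a L \<longleftrightarrow>
     (\<forall>i<j. \<forall>\<^sub>F x in (if a = 0 then at_right 0 else nhds a).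
        gamma_pow \<rho> i f differentiable (at x)) \<and>
     (if a = 0 then (gamma_pow \<rho> j f \<longlongrightarrow> L) (at_right 0) else gamma_pow \<rho> j f a = L)"

text \<open>
  Continuity of the top derivative is only required at the point itself; the lower derivatives are
  continuous near \<open>a\<close> because they are differentiable there.
\<close>

definition cont_diff_at :: "nat \<Rightarrow> (real \<Rightarrow> real) \<Rightarrow> real \<Rightarrow> bool" where
  "cont_diff_at j f a \<longleftrightarrow>
     (\<forall>i<j. \<forall>\<^sub>F x in nhds a. (deriv ^^ i) f differentiable (at x)) \<and>
     isCont ((deriv ^^ j) f) a"

text \<open>
  The coefficients do not depend on any upper bound for the index range, so they are defined for all
  indices. The values for \<open>j = 0\<close> are never used in computing those for \<open>j \<ge> 1\<close>.
\<close>

fun lam :: "real \<Rightarrow> nat \<Rightarrow> nat \<Rightarrow> real" where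
  "lam \<rho> i j =
     (if i = 0 \<or> i > j then 0
      else if i = j then 1
      else lam \<rho> (i - 1) (j - 1) + (real i - real (j - 1) * \<rho>) * lam \<rho> i (j - 1))"

declare lam.simps [simp del]

end

theory Submission
  imports Defs
begin

text \<open>
  Away from \<open>0\<close> the identity \<open>\<gamma>\<^sup>k f = (\<Sum>i=1..k. \<lambda>\<^sub>i\<^sub>,\<^sub>k x\<^bsup>i-k\<rho>\<^esup> f\<^bsup>(i)\<^esup>)\<close> holds pointwise on every open set
  where \<open>f, \<dots>, f\<^bsup>(k-1)\<^esup>\<close> are differentiable: by the product rule, the two terms coming from a summand
  are those of the recursion for \<open>\<lambda>\<close>. For \<open>a \<noteq> 0\<close> the sum is continuous at \<open>a\<close>, so its right limit is
  its value; for \<open>a = 0\<close> both sides are right limits of the same function.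
\<close>

section \<open>Principal powers along the real line\<close>

lemma of_real_powr_has_vector_derivative:
  fixes x :: real and c :: complex
  assumes "x \<noteq> 0"
  shows "((\<lambda>x. complex_of_real x powr c) has_vector_derivative c * complex_of_real x powr (c - 1))
    (at x)"
proof -
  \<comment> \<open>On the half-line \<open>V\<close> containing \<open>x\<close>, \<open>b\<close>
    is the constant imaginary contribution to \<open>Ln\<close>, and \<open>s\<close> is the sign,
    so that \<open>s * y\<close> is the absolute value of \<open>y\<close>.\<close>
  define b :: complex where "b = (if x > 0 then 0 else \<i> * pi)"
  define s :: real where "s = (if x > 0 then 1 else - 1)"
  define V where "V = (if x > 0 then {0<..} else {..<0::real})"
  have V: "open V" "x \<in> V"
    using assms by (auto simp: V_def)
  have Ln: "Ln (complex_of_real y) = complex_of_real (ln (s * y)) + b" if "y \<in> V" for y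
  proof (cases "x > 0")
    case True
    then show ?thesis
      using that by (simp add: b_def s_def V_def Ln_of_real)
  next
    case False
    then have "y < 0"
      using that by (simp add: V_def)
    then show ?thesis
      using False Ln_minus[of "complex_of_real (- y)"] Ln_of_real[of "- y"] by (simp add: b_def s_def)
  qed
  have eq: "exp (c * (complex_of_real (ln (s * y)) + b)) = complex_of_real y powr c" if "y \<in> V" for y
    using Ln[OF that] that by (auto simp: powr_def V_def split: if_splits)
  have "((\<lambda>y. ln (s * y)) has_real_derivative inverse x) (at x)"
    using assms by (auto intro!: derivative_eq_intros simp: field_simps s_def)
  then have "((\<lambda>y. complex_of_real (ln (s * y))) has_vector_derivative complex_of_real (inverse x)) (at x)"
    by (intro has_vector_derivative_of_real)
       (simp add: has_real_derivative_iff_has_vector_derivative)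
  then have "((\<lambda>y. c * (complex_of_real (ln (s * y)) + b)) has_vector_derivative
      c * complex_of_real (inverse x)) (at x)"
    by (intro has_vector_derivative_mult_right) (simp add: has_vector_derivative_add_const)
  from field_vector_diff_chain_at[OF this DERIV_exp]
  have "((\<lambda>y. exp (c * (complex_of_real (ln (s * y)) + b))) has_vector_derivative
      c * complex_of_real (inverse x) * exp (c * (complex_of_real (ln (s * x)) + b))) (at x)"
    by (simp add: o_def)
  then have "((\<lambda>x. complex_of_real x powr c) has_vector_derivative
      c * complex_of_real (inverse x) * exp (c * (complex_of_real (ln (s * x)) + b))) (at x)"
    by (rule has_vector_derivative_transform_within_open[OF _ V]) (simp add: eq)
  moreover have "c * complex_of_real (inverse x) * exp (c * (complex_of_real (ln (s * x)) + b)) =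
      c * complex_of_real x powr (c - 1)"
    unfolding eq[OF V(2)] using assms by (simp add: powr_diff field_simps)
  ultimately show ?thesis
    by (simp only:)
qed

section \<open>The coefficients and the action of \<open>gamma_op\<close> on the sum\<close>

definition gamma_sum :: "real \<Rightarrow> nat \<Rightarrow> (real \<Rightarrow> real) \<Rightarrow> real \<Rightarrow> complex" where
  "gamma_sum \<rho> j f x = (\<Sum>i=1..j. complex_of_real (lam \<rho> i j)
     * complex_of_real x powr complex_of_real (real i - real j * \<rho>)
     * complex_of_real ((deriv ^^ i) f x))"

lemma lam_0_left: "lam \<rho> 0 j = 0"
  by (simp add: lam.simps)

lemma lam_greater: "i > j \<Longrightarrow> lam \<rho> i j = 0"
  by (simp add: lam.simps)

lemma lam_1_1: "lam \<rho> 1 1 = 1"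
  by (simp add: lam.simps)

text \<open>The last branch of the recursion extends to the diagonal and beyond: for
  \<open>i = Suc j\<close> it reads 1 + 0, and for larger \<open>i\<close> all terms vanish. This
  allows one formula for every summand. It fails for \<open>j = 0\<close>, because
  \<open>lam \<rho> 0 0\<close> is 0 while \<open>lam \<rho> 1 1\<close> is 1.\<close>

lemma lam_Suc:
  assumes "i \<ge> 1" and "j \<ge> 1"
  shows "lam \<rho> i (Suc j) = lam \<rho> (i - 1) j + (real i - real j * \<rho>) * lam \<rho> i j"
proof (cases "i \<le> j")
  case True
  then show ?thesis
    using assms by (subst lam.simps) simp
next
  case False
  then have "lam \<rho> i j = 0"
    by (intro lam_greater) simp
  moreover have "lam \<rho> i (Suc j) = lam \<rho> (i - 1) j"
    using False assms by (subst (1 2) lam.simps) auto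
  ultimately show ?thesis
    by simp
qed

lemma deriv_funpow_has_vector_derivative:
  assumes "(deriv ^^ i) f differentiable (at (x::real))"
  shows "((\<lambda>x. complex_of_real ((deriv ^^ i) f x)) has_vector_derivative
    complex_of_real ((deriv ^^ Suc i) f x)) (at x)"
  using assms
  by (intro has_vector_derivative_of_real)
     (simp add: DERIV_deriv_iff_real_differentiable
        flip: has_real_derivative_iff_has_vector_derivative)

lemma gamma_sum_has_vector_derivative:
  assumes "x \<noteq> 0" and diff: "\<forall>i\<le>k. (deriv ^^ i) f differentiable (at x)"
  shows "(gamma_sum \<rho> k f has_vector_derivative
    (\<Sum>i=1..k. complex_of_real (lam \<rho> i k) *
      (complex_of_real (real i - real k * \<rho>)
         * complex_of_real x powr complex_of_real (real i - real k * \<rho> - 1)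
         * complex_of_real ((deriv ^^ i) f x)
       + complex_of_real x powr complex_of_real (real i - real k * \<rho>)
         * complex_of_real ((deriv ^^ Suc i) f x)))) (at x)"
  unfolding gamma_sum_def
proof (rule has_vector_derivative_sum)
  fix i assume "i \<in> {1..k}"
  then have D: "((\<lambda>x. complex_of_real ((deriv ^^ i) f x)) has_vector_derivative
      complex_of_real ((deriv ^^ Suc i) f x)) (at x)"
    by (intro deriv_funpow_has_vector_derivative) (simp add: diff)
  have P: "((\<lambda>x. complex_of_real x powr complex_of_real (real i - real k * \<rho>)) has_vector_derivative
      complex_of_real (real i - real k * \<rho>)
        * complex_of_real x powr complex_of_real (real i - real k * \<rho> - 1)) (at x)"
    using of_real_powr_has_vector_derivative[OF assms(1), of "complex_of_real (real i - real k * \<rho>)"]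
    by simp
  show "((\<lambda>x. complex_of_real (lam \<rho> i k)
        * complex_of_real x powr complex_of_real (real i - real k * \<rho>)
        * complex_of_real ((deriv ^^ i) f x)) has_vector_derivative
      complex_of_real (lam \<rho> i k) *
      (complex_of_real (real i - real k * \<rho>)
         * complex_of_real x powr complex_of_real (real i - real k * \<rho> - 1)
         * complex_of_real ((deriv ^^ i) f x)
       + complex_of_real x powr complex_of_real (real i - real k * \<rho>)
         * complex_of_real ((deriv ^^ Suc i) f x))) (at x)"
    using has_vector_derivative_mult_right[OF has_vector_derivative_mult[OF P D],
        of "complex_of_real (lam \<rho> i k)"]
    by (simp add: algebra_simps)
qed

text \<open>In each summand the factor of exponent \<open>1 - \<rho>\<close> turns the term with
  differentiated power into one of index \<open>i\<close>, and the term with differentiated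
  \<open>f\<close> into one of index \<open>i + 1\<close>, both for order \<open>Suc k\<close>.
  After an index shift the coefficients combine by \<open>lam_Suc\<close>.\<close>

lemma gamma_op_gamma_sum:
  assumes "x \<noteq> 0" and "k \<ge> 1" and "\<forall>i\<le>k. (deriv ^^ i) f differentiable (at x)"
  shows "gamma_op \<rho> (gamma_sum \<rho> k f) x = gamma_sum \<rho> (Suc k) f x"
proof -
  define e where "e i = real i - real (Suc k) * \<rho>" for i
  define X where "X s = complex_of_real x powr complex_of_real s" for s
  define F where "F i = complex_of_real ((deriv ^^ i) f x)" for i
  define l where "l i = complex_of_real (lam \<rho> i k)" for i
  have X: "X r * X s = X (r + s)" for r s
    using assms(1) by (simp add: X_def powr_add)
  \<comment> \<open>Both products are powers with an exponent of order \<open>Suc k\<close>; the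
    second one already belongs to the next index.\<close>
  have X1: "X (1 - \<rho>) * X (real i - real k * \<rho> - 1) = X (e i)"
       "X (1 - \<rho>) * X (real i - real k * \<rho>) = X (e (Suc i))" for i
    unfolding X e_def by (simp_all add: algebra_simps)
  have "gamma_op \<rho> (gamma_sum \<rho> k f) x = X (1 - \<rho>) *
      (\<Sum>i=1..k. l i * (complex_of_real (real i - real k * \<rho>) * X (real i - real k * \<rho> - 1) * F i
        + X (real i - real k * \<rho>) * F (Suc i)))"
    unfolding gamma_op_def X_def F_def l_def
    by (subst vector_derivative_at[OF gamma_sum_has_vector_derivative[OF assms(1,3)]]) (rule refl)
  also have "\<dots> = (\<Sum>i=1..k. l i * (complex_of_real (real i - real k * \<rho>)
        * (X (1 - \<rho>) * X (real i - real k * \<rho> - 1)) * F i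
        + X (1 - \<rho>) * X (real i - real k * \<rho>) * F (Suc i)))"
    unfolding sum_distrib_left by (intro sum.cong refl) (simp only: algebra_simps)
  also have "\<dots> = (\<Sum>i=1..k. complex_of_real (real i - real k * \<rho>) * l i * X (e i) * F i)
      + (\<Sum>i=1..k. l i * X (e (Suc i)) * F (Suc i))"
    unfolding X1 sum.distrib[symmetric] by (intro sum.cong refl) (simp only: algebra_simps)
  \<comment> \<open>The summand for \<open>i = 0\<close> may be added since \<open>lam\<close>
    vanishes there; the shifted range then starts at 1.\<close>
  also have "(\<Sum>i=1..k. l i * X (e (Suc i)) * F (Suc i)) = (\<Sum>i=0..k. l i * X (e (Suc i)) * F (Suc i))"
    by (simp add: sum.atLeast_Suc_atMost[of 0] l_def lam_0_left)
  also have "\<dots> = (\<Sum>i=1..Suc k. l (i - 1) * X (e i) * F i)"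
    using sum.shift_bounds_cl_Suc_ivl[of "\<lambda>i. l (i - 1) * X (e i) * F i" 0 k] by simp
  \<comment> \<open>The summand for \<open>i = Suc k\<close> may be added since
    \<open>lam \<rho> (Suc k) k = 0\<close>, which makes both ranges agree.\<close>
  also have "(\<Sum>i=1..k. complex_of_real (real i - real k * \<rho>) * l i * X (e i) * F i) =
      (\<Sum>i=1..Suc k. complex_of_real (real i - real k * \<rho>) * l i * X (e i) * F i)"
    by (simp add: l_def lam_greater)
  also have "\<dots> + (\<Sum>i=1..Suc k. l (i - 1) * X (e i) * F i) = gamma_sum \<rho> (Suc k) f x"
    unfolding gamma_sum_def sum.distrib[symmetric]
  proof (intro sum.cong refl)
    fix i assume "i \<in> {1..Suc k}"
    then have "complex_of_real (lam \<rho> i (Suc k)) =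
        l (i - 1) + complex_of_real (real i - real k * \<rho>) * l i"
      using assms(2) by (simp add: lam_Suc l_def)
    then show "complex_of_real (real i - real k * \<rho>) * l i * X (e i) * F i + l (i - 1) * X (e i) * F i =
        complex_of_real (lam \<rho> i (Suc k)) * complex_of_real x powr complex_of_real (real i - real (Suc k) * \<rho>)
        * complex_of_real ((deriv ^^ i) f x)"
      unfolding X_def[symmetric] F_def[symmetric] e_def[symmetric] by (simp only: algebra_simps)
  qed
  finally show ?thesis .
qed

section \<open>The iterates on an open set avoiding zero\<close>

lemma gamma_op_transform:
  assumes "open U" and "x \<in> U" and "\<And>y. y \<in> U \<Longrightarrow> g y = h y"
  shows "gamma_op \<rho> g x = gamma_op \<rho> h x"
proof -
  have "\<forall>\<^sub>F y in nhds x. y \<in> UNIV \<longrightarrow> g y = h y"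
    using assms by (auto simp: eventually_nhds)
  then have "vector_derivative g (at x) = vector_derivative h (at x)"
    by (intro vector_derivative_cong_eq) auto
  then show ?thesis
    by (simp add: gamma_op_def)
qed

lemma gamma_pow_Suc: "gamma_pow \<rho> (Suc k) f = gamma_op \<rho> (gamma_pow \<rho> k f)"
  by (simp add: gamma_pow_def)

context
  fixes \<rho> :: real and j :: nat and f :: "real \<Rightarrow> real" and U :: "real set"
  assumes U: "open U" "0 \<notin> U"
    and diff: "\<And>i x. i < j \<Longrightarrow> x \<in> U \<Longrightarrow> (deriv ^^ i) f differentiable (at x)"
begin

text \<open>Since \<open>gamma_op\<close> differentiates, the inductive step needs the identity
  around \<open>x\<close> and not only at \<open>x\<close>; hence the induction runs over all points
  of the open set \<open>U\<close> at once. It starts at 1 because \<open>gamma_sum\<close> of order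
  0 is the empty sum and not \<open>f\<close>.\<close>

lemma gamma_pow_eq_gamma_sum:
  assumes "1 \<le> k" and "k \<le> j" and "x \<in> U"
  shows "gamma_pow \<rho> k f x = gamma_sum \<rho> k f x"
  using assms
proof (induction k arbitrary: x rule: nat_induct_at_least)
  case base
  then have "vector_derivative (\<lambda>x. complex_of_real (f x)) (at x) = complex_of_real (deriv f x)"
    using deriv_funpow_has_vector_derivative[of 0 f x] diff[of 0 x] by (intro vector_derivative_at) simp
  then show ?case
    using lam_1_1 by (simp add: gamma_pow_def gamma_op_def gamma_sum_def)
next
  case (Suc k)
  have "x \<noteq> 0"
    using Suc.prems U by auto
  have "gamma_pow \<rho> (Suc k) f x = gamma_op \<rho> (gamma_sum \<rho> k f) x"
    unfolding gamma_pow_Suc using Suc by (intro gamma_op_transform[OF U(1)]) auto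
  also have "\<dots> = gamma_sum \<rho> (Suc k) f x"
    using \<open>x \<noteq> 0\<close> Suc by (intro gamma_op_gamma_sum) (auto intro: diff)
  finally show ?case .
qed

text \<open>This supplies the first conjunct of \<open>gamma_pow_has_value\<close>. For positive
  \<open>k\<close> differentiability is inherited from the closed form, which agrees with the
  iterate on all of \<open>U\<close>.\<close>

lemma gamma_pow_differentiable:
  assumes "k < j" and "x \<in> U"
  shows "gamma_pow \<rho> k f differentiable (at x)"
proof (cases "k = 0")
  case True
  then show ?thesis
    using deriv_funpow_has_vector_derivative[of 0 f x] diff[of 0 x] assms
    by (auto simp: gamma_pow_def intro: differentiableI_vector)
next
  case False
  have "x \<noteq> 0"
    using assms U by auto
  then have "gamma_sum \<rho> k f differentiable (at x)"
    using assms diff by (intro differentiableI_vector[OF gamma_sum_has_vector_derivative]) auto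
  then have "(gamma_sum \<rho> k f has_vector_derivative vector_derivative (gamma_sum \<rho> k f) (at x)) (at x)"
    by (simp add: vector_derivative_works)
  then have "(gamma_pow \<rho> k f has_vector_derivative vector_derivative (gamma_sum \<rho> k f) (at x)) (at x)"
    using False assms
    by (elim has_vector_derivative_transform_within_open[OF _ U(1)])
       (auto simp: gamma_pow_eq_gamma_sum)
  then show ?thesis
    by (rule differentiableI_vector)
qed

end

section \<open>Passage to the right limit at \<open>a\<close>\<close>

lemma isCont_gamma_sum:
  assumes "x \<noteq> 0" and "\<And>i. i \<le> j \<Longrightarrow> isCont ((deriv ^^ i) f) x"
  shows "isCont (gamma_sum \<rho> j f) x"
  unfolding gamma_sum_def
  using assms of_real_powr_has_vector_derivative[OF assms(1), THEN has_vector_derivative_continuous]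
  by (intro continuous_sum continuous_mult continuous_const continuous_of_real) auto

text \<open>Having the equivalence for every candidate \<open>L\<close> says that the two sides
  exist together and then agree. This matters at \<open>a = 0\<close>, where the limit may fail to
  exist.\<close>

theorem lemma1:
  fixes \<rho> a :: real and j :: nat and f :: "real \<Rightarrow> real" and L :: complex
  assumes "\<rho> > 0" and "j \<ge> 1" and "cont_diff_at j f a"
  shows "gamma_pow_has_value \<rho> j f a L \<longleftrightarrow>
    ((\<lambda>x. \<Sum>i=1..j. complex_of_real (lam \<rho> i j)
        * complex_of_real x powr complex_of_real (real i - real j * \<rho>)
        * complex_of_real ((deriv ^^ i) f x)) \<longlongrightarrow> L) (at_right a)"
proof -
  have cont: "isCont ((deriv ^^ j) f) a"
    using assms by (simp add: cont_diff_at_def)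
  have "\<forall>\<^sub>F x in nhds a. \<forall>i<j. (deriv ^^ i) f differentiable (at x)"
    using assms(3) eventually_ball_finite[of "{..<j}" _ "nhds a"]
    by (simp add: cont_diff_at_def lessThan_def)
  then obtain W where W: "open W" "a \<in> W"
      "\<And>i x. i < j \<Longrightarrow> x \<in> W \<Longrightarrow> (deriv ^^ i) f differentiable (at x)"
    unfolding eventually_nhds by auto
  \<comment> \<open>For \<open>a \<noteq> 0\<close> this is still a neighbourhood of
    \<open>a\<close>; for \<open>a = 0\<close> it is a punctured one, which suffices for limits from
    the right.\<close>
  define U where "U = W - {0}"
  have U: "open U" "0 \<notin> U"
      "\<And>i x. i < j \<Longrightarrow> x \<in> U \<Longrightarrow> (deriv ^^ i) f differentiable (at x)"
    using W by (auto simp: U_def)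
  note eq = gamma_pow_eq_gamma_sum[OF U, of j j, OF _ _ assms(2) order_refl, simplified]
  note gdiff = gamma_pow_differentiable[OF U, of j, simplified]
  have "gamma_pow_has_value \<rho> j f a L \<longleftrightarrow> (gamma_sum \<rho> j f \<longlongrightarrow> L) (at_right a)"
  proof (cases "a = 0")
    case True
    have ev: "\<forall>\<^sub>F x in at_right 0. x \<in> U"
      using W True by (auto simp: U_def eventually_at_topological)
    have "\<forall>\<^sub>F x in at_right 0. gamma_pow \<rho> i f differentiable (at x)" if "i < j" for i
      using ev by eventually_elim (use that gdiff in auto)
    moreover have "\<forall>\<^sub>F x in at_right 0. gamma_pow \<rho> j f x = gamma_sum \<rho> j f x"
      using ev by eventually_elim (use eq in auto)
    then have "(gamma_pow \<rho> j f \<longlongrightarrow> L) (at_right 0) \<longleftrightarrow> (gamma_sum \<rho> j f \<longlongrightarrow> L) (at_right 0)"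
      by (rule tendsto_cong)
    ultimately show ?thesis
      by (simp add: gamma_pow_has_value_def True)
  next
    case False
    then have "a \<in> U"
      using W by (simp add: U_def)
    have ev: "\<forall>\<^sub>F x in nhds a. gamma_pow \<rho> i f differentiable (at x)" if "i < j" for i
      using U(1) \<open>a \<in> U\<close> that gdiff by (auto simp: eventually_nhds)
    have "isCont ((deriv ^^ i) f) a" if "i \<le> j" for i
      using that cont W(2) W(3)[of i a]
      by (cases "i = j") (auto intro: differentiable_imp_continuous_within)
    then have "isCont (gamma_sum \<rho> j f) a"
      by (rule isCont_gamma_sum[OF False])
    then have lim: "(gamma_sum \<rho> j f \<longlongrightarrow> gamma_sum \<rho> j f a) (at_right a)"
      by (auto simp: isCont_def intro: filterlim_at_split[THEN iffD1, THEN conjunct2])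
    \<comment> \<open>Here the right limit always exists, so by uniqueness convergence to
      \<open>L\<close> only says that \<open>L\<close> is the value at \<open>a\<close>.\<close>
    have "(gamma_sum \<rho> j f \<longlongrightarrow> L) (at_right a) \<longleftrightarrow> gamma_sum \<rho> j f a = L"
      using lim tendsto_unique[OF trivial_limit_at_right_real lim, of L] by blast
    then show ?thesis
      using ev eq[OF \<open>a \<in> U\<close>] by (simp add: gamma_pow_has_value_def False)
  qed
  then show ?thesis
    by (simp add: gamma_sum_def[abs_def])
qed

end
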